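(* Let $0\to(V,R_V)\xrightarrow{i}(\hat L,\hat R)\xrightarrow{p}(L,R)\to0$ be a central extension of Reynolds Lie algebras, with $V$ abelian. Then a couple $(d_V,d)\in\mathrm{Der}(V)\times\mathrm{Der}(L)$ is extensible if and only if the obstruction class $[\hat{Ob}_{(d_V,d)}]\in\mathcal{H}^2_R(L;V)$ is trivial.
   Context: All vector spaces are over a fixed ground field. A Reynolds Lie algebra $(L,R)$ is a Lie algebra $(L,[-,-])$ with a linear map $R:L\to L$ satisfying $[Rx,Ry]=R([Rx,y]+[x,Ry]-[Rx,Ry])$; morphisms are Lie algebra homomorphisms commuting with these operators. A Reynolds LieDer pair $(L,R,d)$ is a Reynolds Lie algebra with a derivation $d$ of $L$ such that $R\circ d=d\circ R$; morphisms commute also with the derivations. $(V,R_V)$ is an abelian Reynolds Lie algebra: zero bracket and a linear map $R_V:V\to V$. $\mathrm{Der}(L)$ denotes the derivations $d$ of the Lie algebra $L$ with $d\circ R=R\circ d$; $\mathrm{Der}(V)$ denotes the linear maps $d_V:V\to V$ with $d_V\circ R_V=R_V\circ d_V$. A central extension of $(L,R)$ by $(V,R_V)$ is a short exact sequence $0\to(V,R_V)\xrightarrow{i}(\hat L,\hat R)\xrightarrow{p}(L,R)\to0$ of Reynolds Lie algebra morphisms with $[V,\hat L]_{\hat L}=0$, where $V$ is identified with $i(V)$. A couple $(d_V,d)$ is extensible if there is a derivation $\hat d$ of $\hat L$ such that $0\to(V,R_V,d_V)\xrightarrow{i}(\hat L,\hat R,\hat d)\xrightarrow{p}(L,R,d)\to0$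 is an exact sequence of morphisms of Reynolds LieDer pairs (in particular $\hat R\circ\hat d=\hat d\circ\hat R$). Let $s:L\to\hat L$ be an arbitrary section (linear, $p\circ s=\mathrm{Id}_L$), and put $\psi(a,b)=[s(a),s(b)]_{\hat L}-s([a,b])$, $\xi(a)=\hat R(s(a))-s(R(a))$. Then $\hat{Ob}_{(d_V,d)}=(Ob^2_{(d_V,d)},Ob^1_{(d_V,d)})$ with $$Ob^2_{(d_V,d)}(a,b)=d_V(\psi(a,b))-\psi(d(a),b)-\psi(a,d(b)),\qquad Ob^1_{(d_V,d)}(a)=d_V(\xi(a))-\xi(d(a)).$$ It is a $2$-cocycle of $(L,R)$ with coefficients in the trivial representation ($\rho=0$, with the map $R_V$), and $[\hat{Ob}_{(d_V,d)}]$ is its class. The cohomology $\mathcal{H}^2_R(L;V)$ is taken with coefficients in this trivial representation. $C^n_R(L;V)=\mathrm{Hom}(\wedge^nL,V)\oplus\mathrm{Hom}(\wedge^{n-1}L,V)$ and $D_R(f,g)=(\delta_{CE}f,-\delta_Rg-\varphi f)$, where (for $\rho=0$), on $\mathrm{Hom}(\wedge^nL,V)$, $$(\delta_{CE}f)(x_1,\dots,x_{n+1})=\sum_{1\le i<j\le n+1}(-1)^{i+j+n+1}f([x_i,x_j],x_1,\dots,\hat x_i,\dots,\hat x_j,\dots,x_{n+1}),$$ $\delta_R$ is the same with $[x,y]$ replaced by $[x,y]_R=[x,Ry]+[Rx,y]-[Rx,Ry]$ (both are zero on $\mathrm{Hom}(\wedge^0L,V)=V$), and for $n\ge1$ $$(\varphi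 f)(x_1,\dots,x_n)=f(Rx_1,\dots,Rx_n)-R_V\sum_{i=1}^nf(Rx_1,\dots,Rx_{i-1},x_i,Rx_{i+1},\dots,Rx_n)+(n-1)R_Vf(Rx_1,\dots,Rx_n).$$ $\mathcal{H}^2_R(L;V)$ is $\ker(D_R$ on $C^2_R)$ modulo $D_R(C^1_R)$. *)

theory Defs
  imports
    Complex_Main
    "HOL-Library.Function_Algebras"
    "HOL-Library.Product_Plus"
begin

section \<open>Reynolds Lie algebras and Reynolds LieDer pairs\<close>

text \<open>A vector space over the field \<open>'k\<close> is a type of class \<open>ab_group_add\<close> together with a scalar
  multiplication satisfying the library locale \<open>vector_space\<close>.\<close>

locale lie_algebra = vector_space scale
  for scale :: "'k::field \<Rightarrow> 'a::ab_group_add \<Rightarrow> 'a" +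
  fixes br :: "'a \<Rightarrow> 'a \<Rightarrow> 'a"
  assumes br_linear_left: "Vector_Spaces.linear scale scale (\<lambda>x. br x y)"
    and br_linear_right: "Vector_Spaces.linear scale scale (br x)"
    and br_self: "br x x = 0"
    and jacobi: "br x (br y z) + br y (br z x) + br z (br x y) = 0"

locale reynolds_lie_algebra = lie_algebra scale br
  for scale :: "'k::field \<Rightarrow> 'a::ab_group_add \<Rightarrow> 'a" and br +
  fixes R :: "'a \<Rightarrow> 'a"
  assumes reynolds_linear: "Vector_Spaces.linear scale scale R"
    and reynolds: "br (R x) (R y) = R (br (R x) y + br x (R y) - br (R x) (R y))"

definition lie_derivation ::
  "('k::field \<Rightarrow> 'a::ab_group_add \<Rightarrow> 'a) \<Rightarrow> ('a \<Rightarrow> 'a \<Rightarrow> 'a) \<Rightarrow> ('a \<Rightarrow> 'a) \<Rightarrow> bool" where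
  "lie_derivation scale br d \<longleftrightarrow>
     Vector_Spaces.linear scale scale d \<and> (\<forall>x y. d (br x y) = br (d x) y + br x (d y))"

definition Der ::
  "('k::field \<Rightarrow> 'a::ab_group_add \<Rightarrow> 'a) \<Rightarrow> ('a \<Rightarrow> 'a \<Rightarrow> 'a) \<Rightarrow> ('a \<Rightarrow> 'a) \<Rightarrow> ('a \<Rightarrow> 'a) set" where
  "Der scale br R = {d. lie_derivation scale br d \<and> d \<circ> R = R \<circ> d}"

definition abelian_Der ::
  "('k::field \<Rightarrow> 'v::ab_group_add \<Rightarrow> 'v) \<Rightarrow> ('v \<Rightarrow> 'v) \<Rightarrow> ('v \<Rightarrow> 'v) set" where
  "abelian_Der scale R = {d. Vector_Spaces.linear scale scale d \<and> d \<circ> R = R \<circ> d}"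

locale reynolds_lieder_pair = reynolds_lie_algebra scale br R
  for scale :: "'k::field \<Rightarrow> 'a::ab_group_add \<Rightarrow> 'a" and br R +
  fixes d :: "'a \<Rightarrow> 'a"
  assumes derivation: "lie_derivation scale br d"
    and reynolds_derivation: "R \<circ> d = d \<circ> R"

locale reynolds_lie_hom =
  dom: reynolds_lie_algebra scale1 br1 R1 + cod: reynolds_lie_algebra scale2 br2 R2
  for scale1 :: "'k::field \<Rightarrow> 'a::ab_group_add \<Rightarrow> 'a" and br1 R1
    and scale2 :: "'k \<Rightarrow> 'b::ab_group_add \<Rightarrow> 'b" and br2 R2 +
  fixes f :: "'a \<Rightarrow> 'b"
  assumes hom_linear: "Vector_Spaces.linear scale1 scale2 f"
    and hom_br: "f (br1 x y) = br2 (f x) (f y)"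
    and hom_reynolds: "f \<circ> R1 = R2 \<circ> f"

locale reynolds_lieder_hom =
  dom: reynolds_lieder_pair scale1 br1 R1 d1 + cod: reynolds_lieder_pair scale2 br2 R2 d2 +
  reynolds_lie_hom scale1 br1 R1 scale2 br2 R2 f
  for scale1 :: "'k::field \<Rightarrow> 'a::ab_group_add \<Rightarrow> 'a" and br1 R1 d1
    and scale2 :: "'k \<Rightarrow> 'b::ab_group_add \<Rightarrow> 'b" and br2 R2 d2 and f +
  assumes hom_derivation: "f \<circ> d1 = d2 \<circ> f"

section \<open>Central extensions and extensible couples\<close>

definition short_exact :: "('v \<Rightarrow> 'h) \<Rightarrow> ('h \<Rightarrow> 'l::zero) \<Rightarrow> bool" where
  "short_exact i p \<longleftrightarrow> inj i \<and> range i = {x. p x = 0} \<and> surj p"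

text \<open>The abelian Lie algebra \<open>V\<close> is the vector space \<open>V\<close> with the bracket \<open>\<lambda>_ _. 0\<close>.\<close>

locale central_extension =
  i: reynolds_lie_hom scaleV "\<lambda>_ _. 0" RV scaleH brH RH i +
  p: reynolds_lie_hom scaleH brH RH scaleL brL RL p
  for scaleV :: "'k::field \<Rightarrow> 'v::ab_group_add \<Rightarrow> 'v" and RV
    and i :: "'v \<Rightarrow> 'h::ab_group_add"
    and scaleH :: "'k \<Rightarrow> 'h \<Rightarrow> 'h" and brH RH
    and p :: "'h \<Rightarrow> 'l::ab_group_add"
    and scaleL :: "'k \<Rightarrow> 'l \<Rightarrow> 'l" and brL RL +
  assumes exact: "short_exact i p"
    and central: "brH (i v) x = 0"

definition extensible ::
  "('k::field \<Rightarrow> 'v::ab_group_add \<Rightarrow> 'v) \<Rightarrow> ('v \<Rightarrow> 'v) \<Rightarrow> ('v \<Rightarrow> 'h::ab_group_add) \<Rightarrow>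
   ('k \<Rightarrow> 'h \<Rightarrow> 'h) \<Rightarrow> ('h \<Rightarrow> 'h \<Rightarrow> 'h) \<Rightarrow> ('h \<Rightarrow> 'h) \<Rightarrow> ('h \<Rightarrow> 'l::ab_group_add) \<Rightarrow>
   ('k \<Rightarrow> 'l \<Rightarrow> 'l) \<Rightarrow> ('l \<Rightarrow> 'l \<Rightarrow> 'l) \<Rightarrow> ('l \<Rightarrow> 'l) \<Rightarrow> ('v \<Rightarrow> 'v) \<Rightarrow> ('l \<Rightarrow> 'l) \<Rightarrow> bool" where
  "extensible scaleV RV i scaleH brH RH p scaleL brL RL dV d \<longleftrightarrow>
     (\<exists>dH. lie_derivation scaleH brH dH \<and>
           reynolds_lieder_hom scaleV (\<lambda>_ _. 0) RV dV scaleH brH RH dH i \<and>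
           reynolds_lieder_hom scaleH brH RH dH scaleL brL RL d p \<and>
           short_exact i p)"

section \<open>Cohomology with coefficients in the trivial representation\<close>

text \<open>\<open>Hom(\<And>\<^sup>n L, V)\<close> is the space of alternating \<open>n\<close>-linear maps. Such a map is encoded as a function
  on lists that is zero on all lists whose length is not \<open>n\<close>, so that distinct functions represent
  distinct cochains. The condition for non-distinct lists says that the map vanishes as soon
  as two arguments coincide.\<close>

definition alt_maps ::
  "('k::field \<Rightarrow> 'l::ab_group_add \<Rightarrow> 'l) \<Rightarrow> ('k \<Rightarrow> 'v::ab_group_add \<Rightarrow> 'v) \<Rightarrow> nat \<Rightarrow> ('l list \<Rightarrow> 'v) set"
  where
  "alt_maps scaleL scaleV n = {f.
     (\<forall>xs. length xs \<noteq> n \<longrightarrow> f xs = 0) \<and>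
     (\<forall>xs k. length xs = n \<and> k < n \<longrightarrow> Vector_Spaces.linear scaleL scaleV (\<lambda>x. f (xs[k := x]))) \<and>
     (\<forall>xs. length xs = n \<and> \<not> distinct xs \<longrightarrow> f xs = 0)}"

text \<open>The Chevalley--Eilenberg differential on \<open>Hom(\<And>\<^sup>n L, V)\<close> for an arbitrary bracket \<open>b\<close>. The list
  indices \<open>j < k \<le> n\<close> start at \<open>0\<close>; shifting both of them to start at \<open>1\<close> does not change the
  sign \<open>(-1)\<^sup>j\<^sup>+\<^sup>k\<^sup>+\<^sup>n\<^sup>+\<^sup>1\<close>. For \<open>n = 0\<close> the sum is empty.\<close>

definition ce_diff ::
  "('l \<Rightarrow> 'l \<Rightarrow> 'l) \<Rightarrow> ('k::field \<Rightarrow> 'v::ab_group_add \<Rightarrow> 'v) \<Rightarrow> nat \<Rightarrow> ('l list \<Rightarrow> 'v) \<Rightarrow> 'l list \<Rightarrow> 'v"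
  where
  "ce_diff b scaleV n f xs =
     (if length xs = n + 1
      then \<Sum>k\<le>n. \<Sum>j<k.
             scaleV ((-1) ^ (j + k + n + 1)) (f (b (xs ! j) (xs ! k) # nths xs (- {j, k})))
      else 0)"

definition reynolds_br :: "('l::ab_group_add \<Rightarrow> 'l \<Rightarrow> 'l) \<Rightarrow> ('l \<Rightarrow> 'l) \<Rightarrow> 'l \<Rightarrow> 'l \<Rightarrow> 'l" where
  "reynolds_br br R x y = br x (R y) + br (R x) y - br (R x) (R y)"

text \<open>The map \<open>\<phi>\<close> on \<open>Hom(\<And>\<^sup>n L, V)\<close>; only meaningful for \<open>n \<ge> 1\<close>.\<close>

definition phi_map ::
  "('l \<Rightarrow> 'l) \<Rightarrow> ('k::field \<Rightarrow> 'v::ab_group_add \<Rightarrow> 'v) \<Rightarrow> ('v \<Rightarrow> 'v) \<Rightarrow>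
   nat \<Rightarrow> ('l list \<Rightarrow> 'v) \<Rightarrow> 'l list \<Rightarrow> 'v" where
  "phi_map RL scaleV RV n f xs =
     (if length xs = n
      then f (map RL xs) - RV (\<Sum>k<n. f ((map RL xs)[k := xs ! k]))
           + scaleV (of_nat (n - 1)) (RV (f (map RL xs)))
      else 0)"

text \<open>\<open>C\<^sup>n\<^sub>R(L; V)\<close> and \<open>D\<^sub>R\<close> on it, for \<open>n \<ge> 1\<close>.\<close>

definition cochains ::
  "('k::field \<Rightarrow> 'l::ab_group_add \<Rightarrow> 'l) \<Rightarrow> ('k \<Rightarrow> 'v::ab_group_add \<Rightarrow> 'v) \<Rightarrow> nat \<Rightarrow>
   (('l list \<Rightarrow> 'v) \<times> ('l list \<Rightarrow> 'v)) set" where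
  "cochains scaleL scaleV n = alt_maps scaleL scaleV n \<times> alt_maps scaleL scaleV (n - 1)"

definition reynolds_diff ::
  "('l::ab_group_add \<Rightarrow> 'l \<Rightarrow> 'l) \<Rightarrow> ('l \<Rightarrow> 'l) \<Rightarrow> ('k::field \<Rightarrow> 'v::ab_group_add \<Rightarrow> 'v) \<Rightarrow> ('v \<Rightarrow> 'v) \<Rightarrow>
   nat \<Rightarrow> ('l list \<Rightarrow> 'v) \<times> ('l list \<Rightarrow> 'v) \<Rightarrow> ('l list \<Rightarrow> 'v) \<times> ('l list \<Rightarrow> 'v)" where
  "reynolds_diff brL RL scaleV RV n = (\<lambda>(f, g).
     (ce_diff brL scaleV n f,
      - ce_diff (reynolds_br brL RL) scaleV (n - 1) g - phi_map RL scaleV RV n f))"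

definition cocycles2 ::
  "('k::field \<Rightarrow> 'l::ab_group_add \<Rightarrow> 'l) \<Rightarrow> ('l \<Rightarrow> 'l \<Rightarrow> 'l) \<Rightarrow> ('l \<Rightarrow> 'l) \<Rightarrow>
   ('k \<Rightarrow> 'v::ab_group_add \<Rightarrow> 'v) \<Rightarrow> ('v \<Rightarrow> 'v) \<Rightarrow> (('l list \<Rightarrow> 'v) \<times> ('l list \<Rightarrow> 'v)) set" where
  "cocycles2 scaleL brL RL scaleV RV =
     {c \<in> cochains scaleL scaleV 2. reynolds_diff brL RL scaleV RV 2 c = 0}"

definition coboundaries2 ::
  "('k::field \<Rightarrow> 'l::ab_group_add \<Rightarrow> 'l) \<Rightarrow> ('l \<Rightarrow> 'l \<Rightarrow> 'l) \<Rightarrow> ('l \<Rightarrow> 'l) \<Rightarrow>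
   ('k \<Rightarrow> 'v::ab_group_add \<Rightarrow> 'v) \<Rightarrow> ('v \<Rightarrow> 'v) \<Rightarrow> (('l list \<Rightarrow> 'v) \<times> ('l list \<Rightarrow> 'v)) set" where
  "coboundaries2 scaleL brL RL scaleV RV =
     reynolds_diff brL RL scaleV RV 1 ` cochains scaleL scaleV 1"

text \<open>\<open>H\<^sup>2\<^sub>R(L; V)\<close> is the set \<open>cohomology2\<close> of classes of the relation \<open>cohomologous2\<close>. The relation is
  restricted to cocycles, so a cochain that is not a cocycle has the empty set as its
  \<open>cohomology_class2\<close>, which is not an element of \<open>cohomology2\<close>; the zero element is the class of \<open>0\<close>.\<close>

definition cohomologous2 ::
  "('k::field \<Rightarrow> 'l::ab_group_add \<Rightarrow> 'l) \<Rightarrow> ('l \<Rightarrow> 'l \<Rightarrow> 'l) \<Rightarrow> ('l \<Rightarrow> 'l) \<Rightarrow>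
   ('k \<Rightarrow> 'v::ab_group_add \<Rightarrow> 'v) \<Rightarrow> ('v \<Rightarrow> 'v) \<Rightarrow> (('l list \<Rightarrow> 'v) \<times> ('l list \<Rightarrow> 'v)) rel" where
  "cohomologous2 scaleL brL RL scaleV RV =
     {(c, c'). c \<in> cocycles2 scaleL brL RL scaleV RV \<and> c' \<in> cocycles2 scaleL brL RL scaleV RV \<and>
               c - c' \<in> coboundaries2 scaleL brL RL scaleV RV}"

definition cohomology2 ::
  "('k::field \<Rightarrow> 'l::ab_group_add \<Rightarrow> 'l) \<Rightarrow> ('l \<Rightarrow> 'l \<Rightarrow> 'l) \<Rightarrow> ('l \<Rightarrow> 'l) \<Rightarrow>
   ('k \<Rightarrow> 'v::ab_group_add \<Rightarrow> 'v) \<Rightarrow> ('v \<Rightarrow> 'v) \<Rightarrow> (('l list \<Rightarrow> 'v) \<times> ('l list \<Rightarrow> 'v)) set set" where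
  "cohomology2 scaleL brL RL scaleV RV =
     cocycles2 scaleL brL RL scaleV RV // cohomologous2 scaleL brL RL scaleV RV"

definition cohomology_class2 ::
  "('k::field \<Rightarrow> 'l::ab_group_add \<Rightarrow> 'l) \<Rightarrow> ('l \<Rightarrow> 'l \<Rightarrow> 'l) \<Rightarrow> ('l \<Rightarrow> 'l) \<Rightarrow>
   ('k \<Rightarrow> 'v::ab_group_add \<Rightarrow> 'v) \<Rightarrow> ('v \<Rightarrow> 'v) \<Rightarrow>
   ('l list \<Rightarrow> 'v) \<times> ('l list \<Rightarrow> 'v) \<Rightarrow> (('l list \<Rightarrow> 'v) \<times> ('l list \<Rightarrow> 'v)) set" where
  "cohomology_class2 scaleL brL RL scaleV RV c = cohomologous2 scaleL brL RL scaleV RV `` {c}"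

section \<open>The obstruction cochain\<close>

definition linear_section ::
  "('k::field \<Rightarrow> 'l::ab_group_add \<Rightarrow> 'l) \<Rightarrow> ('k \<Rightarrow> 'h::ab_group_add \<Rightarrow> 'h) \<Rightarrow>
   ('h \<Rightarrow> 'l) \<Rightarrow> ('l \<Rightarrow> 'h) \<Rightarrow> bool" where
  "linear_section scaleL scaleH p s \<longleftrightarrow> Vector_Spaces.linear scaleL scaleH s \<and> p \<circ> s = id"

text \<open>For a section \<open>s\<close> the arguments of \<open>inv i\<close> below lie in the kernel of \<open>p\<close>, that is, in \<open>i(V)\<close>;
  \<open>inv i\<close> is the identification of \<open>i(V)\<close> with \<open>V\<close>.\<close>

definition ext_psi ::
  "('v \<Rightarrow> 'h::ab_group_add) \<Rightarrow> ('h \<Rightarrow> 'h \<Rightarrow> 'h) \<Rightarrow> ('l \<Rightarrow> 'l \<Rightarrow> 'l) \<Rightarrow> ('l \<Rightarrow> 'h) \<Rightarrow> 'l \<Rightarrow> 'l \<Rightarrow> 'v" where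
  "ext_psi i brH brL s a b = inv i (brH (s a) (s b) - s (brL a b))"

definition ext_xi ::
  "('v \<Rightarrow> 'h::ab_group_add) \<Rightarrow> ('h \<Rightarrow> 'h) \<Rightarrow> ('l \<Rightarrow> 'l) \<Rightarrow> ('l \<Rightarrow> 'h) \<Rightarrow> 'l \<Rightarrow> 'v" where
  "ext_xi i RH RL s a = inv i (RH (s a) - s (RL a))"

definition obstruction ::
  "('v::ab_group_add \<Rightarrow> 'h::ab_group_add) \<Rightarrow> ('h \<Rightarrow> 'h \<Rightarrow> 'h) \<Rightarrow> ('h \<Rightarrow> 'h) \<Rightarrow>
   ('l \<Rightarrow> 'l \<Rightarrow> 'l) \<Rightarrow> ('l \<Rightarrow> 'l) \<Rightarrow> ('l \<Rightarrow> 'h) \<Rightarrow> ('v \<Rightarrow> 'v) \<Rightarrow> ('l \<Rightarrow> 'l) \<Rightarrow>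
   ('l list \<Rightarrow> 'v) \<times> ('l list \<Rightarrow> 'v)" where
  "obstruction i brH RH brL RL s dV d =
     (let \<psi> = ext_psi i brH brL s; \<xi> = ext_xi i RH RL s
      in (\<lambda>xs. case xs of [a, b] \<Rightarrow> dV (\<psi> a b) - \<psi> (d a) b - \<psi> a (d b) | _ \<Rightarrow> 0,
          \<lambda>xs. case xs of [a] \<Rightarrow> dV (\<xi> a) - \<xi> (d a) | _ \<Rightarrow> 0))"

end

theory Submission
  imports Defs
begin

text \<open>
  Write \<open>L'\<close> and \<open>R'\<close> for the middle algebra of the extension and its operator.
  The section \<open>s\<close> splits \<open>L'\<close> as a vector space: \<open>h = i (q h) + s (p h)\<close> for a linear retraction
  \<open>q\<close> of \<open>i\<close>. In these coordinates the extension is described by the pair \<open>(\<psi>, \<xi>)\<close>: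
  \<open>p\<close> turns bracket and operator of \<open>L'\<close> into those of \<open>L\<close>, while the \<open>V\<close>-components are
  \<open>q [x, y] = \<psi> (p x) (p y)\<close>, because \<open>V\<close> is central, and \<open>q (R' x) = R\<^sub>V (q x) + \<xi> (p x)\<close>.

  A linear map \<open>d'\<close> on \<open>L'\<close> which is \<open>d\<^sub>V\<close> on \<open>V\<close> and induces \<open>d\<close> on \<open>L\<close> is the same thing as a
  linear map \<open>l : L \<rightarrow> V\<close>, through \<open>q (d' x) = d\<^sub>V (q x) + l (p x)\<close>. Only the \<open>V\<close>-components of the
  two identities required of \<open>d'\<close> carry information, since the \<open>L\<close>-components hold for \<open>d\<close>. They read
  \<open>Ob\<^sup>2(a, b) = - l [a, b]\<close> (\<open>d'\<close> is a derivation) and \<open>Ob\<^sup>1(a) = R\<^sub>V (l a) - l (R a)\<close>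
  (\<open>d'\<close> commutes with \<open>R'\<close>). The right-hand sides form exactly the coboundary of \<open>l\<close>
  (lemma \<open>coboundaries2_eq\<close>), so the extensions \<open>d'\<close> correspond to the primitives of the obstruction.

  For the passage from cochains to classes one also needs that the obstruction is a cocycle
  (lemma \<open>obstruction_cocycle\<close>). The pair \<open>(\<psi>, \<xi>)\<close> satisfies the cocycle identities, which are the
  \<open>V\<close>-components of the Jacobi and Reynolds identities of \<open>L'\<close>; and the obstruction arises from
  \<open>(\<psi>, \<xi>)\<close> by the infinitesimal action of \<open>(d\<^sub>V, d)\<close>, which preserves them.
\<close>

section \<open>Cochains of low degree\<close>

definition cochain1 :: "('l \<Rightarrow> 'v::zero) \<Rightarrow> 'l list \<Rightarrow> 'v" where
  "cochain1 f xs = (case xs of [a] \<Rightarrow> f a | _ \<Rightarrow> 0)"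

definition cochain2 :: "('l \<Rightarrow> 'l \<Rightarrow> 'v::zero) \<Rightarrow> 'l list \<Rightarrow> 'v" where
  "cochain2 F xs = (case xs of [a, b] \<Rightarrow> F a b | _ \<Rightarrow> 0)"

lemma cochain1_simps [simp]: "cochain1 f [a] = f a" "length xs \<noteq> 1 \<Longrightarrow> cochain1 f xs = 0"
  by (auto simp: cochain1_def split: list.split)

lemma cochain2_simps [simp]: "cochain2 F [a, b] = F a b" "length xs \<noteq> 2 \<Longrightarrow> cochain2 F xs = 0"
  by (auto simp: cochain2_def split: list.split)

lemma cochain1_eqI:
  assumes "\<And>a. c [a] = f a" "\<And>xs. length xs \<noteq> 1 \<Longrightarrow> c xs = 0"
  shows "c = cochain1 f"
proof
  fix xs :: "'a list"
  show "c xs = cochain1 f xs"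
    using assms by (cases "length xs = 1") (auto simp: length_Suc_conv)
qed

lemma cochain2_eqI:
  assumes "\<And>a b. c [a, b] = F a b" "\<And>xs. length xs \<noteq> 2 \<Longrightarrow> c xs = 0"
  shows "c = cochain2 F"
proof
  fix xs :: "'a list"
  show "c xs = cochain2 F xs"
    using assms by (cases "length xs = 2") (auto simp: length_Suc_conv numeral_2_eq_2)
qed

lemma cochain1_eq_iff [simp]: "cochain1 f = cochain1 g \<longleftrightarrow> f = g"
  by (metis cochain1_simps(1) ext)

lemma cochain2_eq_iff [simp]: "cochain2 F = cochain2 G \<longleftrightarrow> F = G"
  by (metis cochain2_simps(1) ext)

lemma cochain1_zero [simp]: "cochain1 (\<lambda>_. 0) = 0"
  by (rule cochain1_eqI[symmetric]) simp_all

lemma cochain2_zero [simp]: "cochain2 (\<lambda>_ _. 0) = 0"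
  by (rule cochain2_eqI[symmetric]) simp_all

lemma cochain1_diff: "cochain1 f - cochain1 g = cochain1 (\<lambda>a. f a - g a :: 'v::ab_group_add)"
  by (rule cochain1_eqI) auto

lemma cochain2_diff:
  "cochain2 F - cochain2 G = cochain2 (\<lambda>a b. F a b - G a b :: 'v::ab_group_add)"
  by (rule cochain2_eqI) auto

lemma alt_maps_0I:
  assumes "\<And>xs. xs \<noteq> [] \<Longrightarrow> g xs = 0"
  shows "g \<in> alt_maps scaleL scaleV 0"
  using assms by (auto simp: alt_maps_def)

lemma alt_maps_1_eq:
  "alt_maps scaleL scaleV 1 = cochain1 ` {f. Vector_Spaces.linear scaleL scaleV f}"
proof (intro equalityI subsetI)
  fix c assume c: "c \<in> alt_maps scaleL scaleV 1"
  have "c = cochain1 (\<lambda>a. c [a])"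
    using c by (intro cochain1_eqI) (auto simp: alt_maps_def)
  moreover have "length xs = 1 \<and> k < 1 \<longrightarrow> Vector_Spaces.linear scaleL scaleV (\<lambda>a. c (xs[k := a]))"
    for xs k
    using c by (simp add: alt_maps_def)
  \<comment> \<open>Any one-element list serves here: its entry is overwritten.\<close>
  from this[of "[undefined]" 0] have "Vector_Spaces.linear scaleL scaleV (\<lambda>a. c [a])"
    by simp
  ultimately show "c \<in> cochain1 ` {f. Vector_Spaces.linear scaleL scaleV f}"
    by auto
next
  fix c assume "c \<in> cochain1 ` {f. Vector_Spaces.linear scaleL scaleV f}"
  then show "c \<in> alt_maps scaleL scaleV 1"
    by (auto simp: alt_maps_def length_Suc_conv)
qed

lemma cochain2_in_alt_maps:
  assumes "\<And>b. Vector_Spaces.linear scaleL scaleV (\<lambda>a. F a b)"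
    and "\<And>a. Vector_Spaces.linear scaleL scaleV (F a)"
    and "\<And>a. F a a = 0"
  shows "cochain2 F \<in> alt_maps scaleL scaleV 2"
  unfolding alt_maps_def
proof (intro CollectI conjI allI impI)
  fix xs :: "'a list" and k :: nat
  assume "length xs = 2 \<and> k < 2"
  then obtain a b where "xs = [a, b]" and "k = 0 \<or> k = 1"
    by (auto simp: length_Suc_conv numeral_2_eq_2 less_Suc_eq)
  then show "Vector_Spaces.linear scaleL scaleV (\<lambda>x. cochain2 F (xs[k := x]))"
    using assms(1)[of b] assms(2)[of a] by auto
next
  fix xs :: "'a list"
  assume "length xs = 2 \<and> \<not> distinct xs"
  then show "cochain2 F xs = 0"
    using assms(3) by (auto simp: length_Suc_conv numeral_2_eq_2)
qed simp

section \<open>The second cohomology with trivial coefficients\<close>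

locale trivial_representation =
  L: reynolds_lie_algebra scaleL brL RL + V: vector_space scaleV
  for scaleL :: "'k::field \<Rightarrow> 'l::ab_group_add \<Rightarrow> 'l" and brL RL
    and scaleV :: "'k \<Rightarrow> 'v::ab_group_add \<Rightarrow> 'v" +
  fixes RV :: "'v \<Rightarrow> 'v"
  assumes RV_linear: "Vector_Spaces.linear scaleV scaleV RV"
begin

lemma RV_simps:
  "RV 0 = 0" "RV (x + y) = RV x + RV y" "RV (x - y) = RV x - RV y" "RV (- x) = - RV x"
proof -
  interpret Vector_Spaces.linear scaleV scaleV RV by (fact RV_linear)
  show "RV 0 = 0" "RV (x + y) = RV x + RV y" "RV (x - y) = RV x - RV y" "RV (- x) = - RV x"
    by (simp_all add: zero add diff neg)
qed

text \<open>The two components of \<open>D\<^sub>R (F, G) = 0\<close> written out: \<open>lie\<close> is the three-term sum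
  \<open>\<delta>\<^sub>C\<^sub>E F\<close>, and \<open>reynolds\<close> is \<open>-\<delta>\<^sub>R G - \<phi> F = 0\<close>. In degree one \<open>\<delta>\<^sub>R\<close> carries
  the sign \<open>-1\<close>, so that \<open>-\<delta>\<^sub>R G\<close> is \<open>G\<close> of the modified bracket.\<close>

lemma cocycles2I:
  assumes left: "\<And>b. Vector_Spaces.linear scaleL scaleV (\<lambda>a. F a b)"
    and right: "\<And>a. Vector_Spaces.linear scaleL scaleV (F a)"
    and self: "\<And>a. F a a = 0"
    and G: "Vector_Spaces.linear scaleL scaleV G"
    and lie: "\<And>a b c. F (brL a b) c - F (brL a c) b + F (brL b c) a = 0"
    and reynolds: "\<And>a b. G (reynolds_br brL RL a b) =
      F (RL a) (RL b) - RV (F a (RL b) + F (RL a) b - F (RL a) (RL b))"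
  shows "(cochain2 F, cochain1 G) \<in> cocycles2 scaleL brL RL scaleV RV"
proof -
  have "ce_diff brL scaleV 2 (cochain2 F) xs = 0" for xs
  proof (cases "length xs = 3")
    case True
    then obtain a b c where "xs = [a, b, c]"
      by (auto simp: length_Suc_conv numeral_3_eq_3)
    then show ?thesis
      using lie[of a b c]
      by (simp add: ce_diff_def numeral_2_eq_2 nths_Cons algebra_simps)
  qed (simp add: ce_diff_def)
  moreover have "(- ce_diff (reynolds_br brL RL) scaleV 1 (cochain1 G)
      - phi_map RL scaleV RV 2 (cochain2 F)) xs = 0" for xs
  proof (cases "length xs = 2")
    case True
    then obtain a b where "xs = [a, b]"
      by (auto simp: length_Suc_conv numeral_2_eq_2)
    then show ?thesis
      using reynolds[of a b]
      by (simp add: ce_diff_def phi_map_def numeral_2_eq_2 nths_Cons RV_simps)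
  qed (simp add: ce_diff_def phi_map_def)
  ultimately show ?thesis
    using cochain2_in_alt_maps[of scaleL scaleV F, OF left right self] G
    by (auto simp: cocycles2_def cochains_def reynolds_diff_def zero_prod_def
        alt_maps_1_eq[unfolded One_nat_def] fun_eq_iff)
qed

text \<open>Since \<open>\<delta>\<^sub>R\<close> vanishes on \<open>Hom(\<And>\<^sup>0 L, V)\<close>, a coboundary of degree two is determined by a
  single linear map \<open>L \<rightarrow> V\<close>.\<close>

lemma reynolds_diff_1:
  "reynolds_diff brL RL scaleV RV 1 (cochain1 f, g) =
    (cochain2 (\<lambda>a b. - f (brL a b)), cochain1 (\<lambda>a. RV (f a) - f (RL a)))"
proof -
  have "ce_diff brL scaleV 1 (cochain1 f) = cochain2 (\<lambda>a b. - f (brL a b))"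
    by (rule cochain2_eqI) (simp_all add: ce_diff_def nths_Cons)
  moreover have "- ce_diff (reynolds_br brL RL) scaleV 0 g - phi_map RL scaleV RV 1 (cochain1 f)
      = cochain1 (\<lambda>a. RV (f a) - f (RL a))"
    by (rule cochain1_eqI) (simp_all add: ce_diff_def phi_map_def)
  ultimately show ?thesis
    by (simp add: reynolds_diff_def)
qed

lemma coboundaries2_eq:
  "coboundaries2 scaleL brL RL scaleV RV =
    (\<lambda>f. (cochain2 (\<lambda>a b. - f (brL a b)), cochain1 (\<lambda>a. RV (f a) - f (RL a)))) `
      {f. Vector_Spaces.linear scaleL scaleV f}" (is "_ = ?B ` _")
proof -
  have "(\<lambda>_. 0) \<in> alt_maps scaleL scaleV 0"
    by (rule alt_maps_0I) simp
  then have "coboundaries2 scaleL brL RL scaleV RV =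
      (\<lambda>f. reynolds_diff brL RL scaleV RV 1 (cochain1 f, \<lambda>_. 0)) `
        {f. Vector_Spaces.linear scaleL scaleV f}"
    unfolding coboundaries2_def cochains_def alt_maps_1_eq
    by (force simp: reynolds_diff_1[unfolded One_nat_def])
  then show ?thesis
    by (simp only: reynolds_diff_1)
qed

lemma zero_mem_coboundaries2: "0 \<in> coboundaries2 scaleL brL RL scaleV RV"
proof -
  have "Vector_Spaces.linear scaleL scaleV (\<lambda>_. 0)"
    by (simp add: Vector_Spaces.linear_iff L.vector_space_axioms V.vector_space_axioms)
  then show ?thesis
    unfolding coboundaries2_eq
    by (rule image_eqI[rotated, where x = "\<lambda>_. 0", OF CollectI])
      (simp add: zero_prod_def RV_simps)
qed

lemma diff_mem_coboundaries2:
  assumes "c \<in> coboundaries2 scaleL brL RL scaleV RV"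
    and "c' \<in> coboundaries2 scaleL brL RL scaleV RV"
  shows "c - c' \<in> coboundaries2 scaleL brL RL scaleV RV"
proof -
  obtain f g where f: "Vector_Spaces.linear scaleL scaleV f"
      "c = (cochain2 (\<lambda>a b. - f (brL a b)), cochain1 (\<lambda>a. RV (f a) - f (RL a)))"
    and g: "Vector_Spaces.linear scaleL scaleV g"
      "c' = (cochain2 (\<lambda>a b. - g (brL a b)), cochain1 (\<lambda>a. RV (g a) - g (RL a)))"
    using assms unfolding coboundaries2_eq by auto
  have "Vector_Spaces.linear scaleL scaleV (\<lambda>a. f a - g a)"
    using f(1) g(1) by (simp add: Vector_Spaces.linear_iff V.scale_right_diff_distrib)
  moreover have "c - c' = (cochain2 (\<lambda>a b. - (f (brL a b) - g (brL a b))),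
      cochain1 (\<lambda>a. RV (f a - g a) - (f (RL a) - g (RL a))))"
    unfolding f g minus_prod_def
    by (simp add: cochain1_diff cochain2_diff RV_simps algebra_simps)
  ultimately show ?thesis
    unfolding coboundaries2_eq by (intro image_eqI[where x = "\<lambda>a. f a - g a"]) auto
qed

lemma zero_mem_cocycles2: "0 \<in> cocycles2 scaleL brL RL scaleV RV"
proof -
  have "Vector_Spaces.linear scaleL scaleV (\<lambda>_. 0)"
    by (simp add: Vector_Spaces.linear_iff L.vector_space_axioms V.vector_space_axioms)
  have "(cochain2 (\<lambda>_ _. 0), cochain1 (\<lambda>_. 0)) \<in> cocycles2 scaleL brL RL scaleV RV"
    by (rule cocycles2I) (simp_all add: RV_simps \<open>Vector_Spaces.linear scaleL scaleV (\<lambda>_. 0)\<close>)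
  then show ?thesis
    by (simp add: zero_prod_def)
qed

text \<open>The class of a cochain which is not a cocycle is empty and so never the class of \<open>0\<close>;
  therefore the equivalence is about cocycles.\<close>

lemma cohomology_class2_eq_zero_iff:
  assumes c: "c \<in> cocycles2 scaleL brL RL scaleV RV"
  shows "cohomology_class2 scaleL brL RL scaleV RV c = cohomology_class2 scaleL brL RL scaleV RV 0
    \<longleftrightarrow> c \<in> coboundaries2 scaleL brL RL scaleV RV" (is "?class c = ?class 0 \<longleftrightarrow> c \<in> ?B")
proof
  assume eq: "?class c = ?class 0"
  have "0 \<in> ?class 0"
    using zero_mem_cocycles2 zero_mem_coboundaries2
    by (simp add: cohomology_class2_def cohomologous2_def)
  then have "0 \<in> ?class c"
    by (simp add: eq)
  then show "c \<in> ?B"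
    by (simp add: cohomology_class2_def cohomologous2_def)
next
  assume cB: "c \<in> ?B"
  have "c - c' \<in> ?B \<longleftrightarrow> 0 - c' \<in> ?B" for c'
  proof
    assume "c - c' \<in> ?B"
    from diff_mem_coboundaries2[OF this cB] show "0 - c' \<in> ?B"
      by simp
  next
    assume "0 - c' \<in> ?B"
    from diff_mem_coboundaries2[OF zero_mem_coboundaries2 this]
    have "c' \<in> ?B" by simp
    from diff_mem_coboundaries2[OF cB this] show "c - c' \<in> ?B" .
  qed
  then show "?class c = ?class 0"
    using c zero_mem_cocycles2 by (auto simp: cohomology_class2_def cohomologous2_def)
qed

end

section \<open>The splitting of a central extension by a section\<close>

locale split_central_extension =
  central_extension scaleV RV i scaleH brH RH p scaleL brL RL
  for scaleV :: "'k::field \<Rightarrow> 'v::ab_group_add \<Rightarrow> 'v" and RV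
    and i :: "'v \<Rightarrow> 'h::ab_group_add"
    and scaleH :: "'k \<Rightarrow> 'h \<Rightarrow> 'h" and brH RH
    and p :: "'h \<Rightarrow> 'l::ab_group_add"
    and scaleL :: "'k \<Rightarrow> 'l \<Rightarrow> 'l" and brL RL +
  fixes s :: "'l \<Rightarrow> 'h"
  assumes linear_section: "linear_section scaleL scaleH p s"
begin

sublocale trivial_representation scaleL brL RL scaleV RV
  by (rule trivial_representation.intro[OF p.cod.reynolds_lie_algebra_axioms
        i.dom.vector_space_axioms trivial_representation_axioms.intro[OF i.dom.reynolds_linear]])

sublocale i_lin: Vector_Spaces.linear scaleV scaleH i by (fact i.hom_linear)
sublocale p_lin: Vector_Spaces.linear scaleH scaleL p by (fact p.hom_linear)
sublocale s_lin: Vector_Spaces.linear scaleL scaleH s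
  using linear_section by (simp add: linear_section_def)
sublocale RH_lin: Vector_Spaces.linear scaleH scaleH RH by (fact i.cod.reynolds_linear)
sublocale brH_left: Vector_Spaces.linear scaleH scaleH "\<lambda>x. brH x y" for y
  by (fact i.cod.br_linear_left)
sublocale brH_right: Vector_Spaces.linear scaleH scaleH "brH x" for x
  by (fact i.cod.br_linear_right)

lemmas additive_simps =
  i_lin.add i_lin.diff i_lin.zero i_lin.neg p_lin.add p_lin.diff p_lin.zero
  s_lin.add s_lin.diff s_lin.zero s_lin.neg RH_lin.add RH_lin.diff
  brH_left.add brH_left.diff brH_right.add brH_right.diff

lemma p_s [simp]: "p (s a) = a"
  using linear_section pointfree_idE[of p s a] by (simp only: linear_section_def)

lemma inj_i: "inj i" and p_eq_0_iff: "p h = 0 \<longleftrightarrow> h \<in> range i"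
  using exact unfolding short_exact_def by blast+

lemma p_i [simp]: "p (i v) = 0"
  unfolding p_eq_0_iff by (rule rangeI)

lemma i_eq_iff [simp]: "i v = i w \<longleftrightarrow> v = w"
  using inj_i by (simp add: inj_eq)

lemma p_br [simp]: "p (brH x y) = brL (p x) (p y)"
  by (fact p.hom_br)

lemma p_RH [simp]: "p (RH x) = RL (p x)"
  using fun_cong[OF p.hom_reynolds, of x] by (simp only: o_apply)

lemma RH_i [simp]: "RH (i v) = i (RV v)"
  using fun_cong[OF i.hom_reynolds, of v] by (simp only: o_apply)

lemma brH_antisym: "brH x y = - brH y x"
proof -
  have "brH (x + y) (x + y) = brH x y + brH y x"
    by (simp only: brH_left.add brH_right.add) (simp add: i.cod.br_self)
  then have "brH x y + brH y x = 0"
    by (simp only: i.cod.br_self)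
  then show ?thesis
    by (simp only: eq_neg_iff_add_eq_0)
qed

lemma central_right: "brH x (i v) = 0"
  using brH_antisym[of x "i v"] by (simp add: central)

text \<open>The linear projection of the middle algebra onto \<open>V\<close> along \<open>s(L)\<close>, that is, the retraction of
  \<open>i\<close> with kernel \<open>s(L)\<close>. Two elements agree as soon as their images under \<open>q\<close> and \<open>p\<close> do.\<close>

definition q :: "'h \<Rightarrow> 'v" where
  "q h = inv i (h - s (p h))"

lemma i_q: "i (q h) = h - s (p h)"
  unfolding q_def by (rule f_inv_into_f) (simp add: additive_simps flip: p_eq_0_iff)

lemma decompose: "h = i (q h) + s (p h)"
  by (simp add: i_q)

lemma q_eqI: "h = i v + s a \<Longrightarrow> q h = v"
  by (simp add: i_q p_lin.add flip: i_eq_iff)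

lemma q_i [simp]: "q (i v) = v"
  by (rule q_eqI[of _ _ 0]) (simp add: additive_simps)

lemma q_s [simp]: "q (s a) = 0"
  by (rule q_eqI[of _ _ a]) (simp add: additive_simps)

lemma q_linear: "Vector_Spaces.linear scaleH scaleV q"
proof -
  have "q (x + y) = q x + q y" for x y
    by (simp add: i_q additive_simps algebra_simps flip: i_eq_iff)
  moreover have "q (scaleH r x) = scaleV r (q x)" for r x
    by (simp add: i_q i_lin.scale p_lin.scale s_lin.scale i.cod.scale_right_diff_distrib
        flip: i_eq_iff)
  ultimately show ?thesis
    by (simp add: Vector_Spaces.linear_iff i.dom.vector_space_axioms i.cod.vector_space_axioms)
qed

sublocale q_lin: Vector_Spaces.linear scaleH scaleV q by (fact q_linear)

abbreviation \<psi> where "\<psi> \<equiv> ext_psi i brH brL s"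
abbreviation \<xi> where "\<xi> \<equiv> ext_xi i RH RL s"

lemma psi_eq: "\<psi> a b = q (brH (s a) (s b))"
  by (simp add: ext_psi_def q_def)

lemma xi_eq: "\<xi> a = q (RH (s a))"
  by (simp add: ext_xi_def q_def)

lemma brH_s: "brH (s a) (s b) = i (\<psi> a b) + s (brL a b)"
  by (simp add: psi_eq i_q)

lemma RH_s: "RH (s a) = i (\<xi> a) + s (RL a)"
  by (simp add: xi_eq i_q)

text \<open>The bracket cannot see the \<open>V\<close>-components of its arguments, because \<open>V\<close> is central.\<close>

lemma brH_eq: "brH x y = brH (s (p x)) (s (p y))"
proof -
  have "brH (i (q x) + s (p x)) (i (q y) + s (p y)) = brH (s (p x)) (s (p y))"
    by (simp only: brH_left.add brH_right.add central central_right add_0_left)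
  then show ?thesis
    by (simp flip: decompose)
qed

lemma q_br: "q (brH x y) = \<psi> (p x) (p y)"
  unfolding psi_eq by (rule arg_cong[OF brH_eq])

lemma q_RH: "q (RH h) = RV (q h) + \<xi> (p h)"
proof (rule q_eqI)
  have "RH (i (q h) + s (p h)) = i (RV (q h) + \<xi> (p h)) + s (RL (p h))"
    by (simp add: additive_simps RH_s)
  then show "RH h = i (RV (q h) + \<xi> (p h)) + s (RL (p h))"
    by (simp flip: decompose)
qed

lemma psi_linear_left: "Vector_Spaces.linear scaleL scaleV (\<lambda>a. \<psi> a b)"
  using Vector_Spaces.linear_compose[OF s_lin.linear_axioms Vector_Spaces.linear_compose[OF brH_left.linear_axioms q_linear]]
  by (simp add: psi_eq o_def)

lemma psi_linear_right: "Vector_Spaces.linear scaleL scaleV (\<psi> a)"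
  using Vector_Spaces.linear_compose[OF s_lin.linear_axioms Vector_Spaces.linear_compose[OF brH_right.linear_axioms q_linear]]
  by (simp add: psi_eq[abs_def] o_def)

lemma xi_linear: "Vector_Spaces.linear scaleL scaleV \<xi>"
  using Vector_Spaces.linear_compose[OF s_lin.linear_axioms Vector_Spaces.linear_compose[OF RH_lin.linear_axioms q_linear]]
  by (simp add: xi_eq[abs_def] o_def)

sublocale psi_left: Vector_Spaces.linear scaleL scaleV "\<lambda>a. \<psi> a b" for b
  by (fact psi_linear_left)
sublocale psi_right: Vector_Spaces.linear scaleL scaleV "\<psi> a" for a
  by (fact psi_linear_right)
sublocale xi_lin: Vector_Spaces.linear scaleL scaleV \<xi> by (fact xi_linear)

lemma psi_self: "\<psi> a a = 0"
  by (simp add: psi_eq i.cod.br_self q_lin.zero)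

lemma psi_antisym: "\<psi> a b = - \<psi> b a"
  unfolding psi_eq by (subst brH_antisym) (rule q_lin.neg)

text \<open>This is the \<open>V\<close>-component of the Jacobi identity for \<open>s a\<close>, \<open>s b\<close>, \<open>s c\<close>, rearranged by
  antisymmetry into the form of the Chevalley--Eilenberg differential.\<close>

lemma psi_jacobi: "\<psi> (brL a b) c - \<psi> (brL a c) b + \<psi> (brL b c) a = 0"
proof -
  have "\<psi> a (brL b c) + \<psi> b (brL c a) + \<psi> c (brL a b) =
      q (brH (s a) (brH (s b) (s c)) + brH (s b) (brH (s c) (s a)) + brH (s c) (brH (s a) (s b)))"
    by (simp add: q_lin.add q_br)
  also have "\<dots> = 0"
    by (simp only: i.cod.jacobi q_lin.zero)
  finally have *: "\<psi> a (brL b c) + \<psi> b (brL c a) + \<psi> c (brL a b) = 0" .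
  have "brL c a = - brL a c"
    using arg_cong[OF brH_antisym[of "s c" "s a"], of p] by (simp add: p_lin.neg)
  then show ?thesis
    using * psi_antisym[of "brL a b" c] psi_antisym[of "brL a c" b] psi_antisym[of "brL b c" a]
    by (simp add: psi_right.neg algebra_simps)
qed

text \<open>This is the \<open>V\<close>-component of the Reynolds identity for \<open>s a\<close> and \<open>s b\<close>.\<close>

lemma psi_xi_reynolds:
  "\<xi> (reynolds_br brL RL a b) =
    \<psi> (RL a) (RL b) - RV (\<psi> a (RL b) + \<psi> (RL a) b - \<psi> (RL a) (RL b))"
proof -
  have "\<psi> (RL a) (RL b) = q (brH (RH (s a)) (RH (s b)))"
    by (simp add: q_br)
  also have "\<dots> = q (RH (brH (RH (s a)) (s b) + brH (s a) (RH (s b)) - brH (RH (s a)) (RH (s b))))"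
    by (rule arg_cong[OF i.cod.reynolds, of q])
  also have "\<dots> = RV (\<psi> (RL a) b + \<psi> a (RL b) - \<psi> (RL a) (RL b))
      + \<xi> (brL (RL a) b + brL a (RL b) - brL (RL a) (RL b))"
    by (simp add: q_RH q_lin.add q_lin.diff p_lin.add p_lin.diff q_br)
  finally show ?thesis
    by (simp add: reynolds_br_def eq_diff_eq add.commute)
qed

section \<open>The obstruction\<close>

context
  fixes dV d
  assumes dV: "dV \<in> abelian_Der scaleV RV" and d: "d \<in> Der scaleL brL RL"
begin

interpretation dV_lin: Vector_Spaces.linear scaleV scaleV dV
  using dV by (simp add: abelian_Der_def)

interpretation d_lin: Vector_Spaces.linear scaleL scaleL d
  using d by (simp add: Der_def lie_derivation_def)

lemma dV_RV: "dV (RV v) = RV (dV v)"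
  using dV by (simp add: abelian_Der_def fun_eq_iff)

lemma d_RL: "d (RL a) = RL (d a)"
  using d by (simp add: Der_def fun_eq_iff)

lemma d_br: "d (brL a b) = brL (d a) b + brL a (d b)"
  using d by (simp add: Der_def lie_derivation_def)

text \<open>Since \<open>d\<close> commutes with \<open>R\<close>, it is a derivation of the modified bracket as well. This
  makes its action compatible with the second cocycle identity.\<close>

lemma d_reynolds_br:
  "d (reynolds_br brL RL a b) = reynolds_br brL RL (d a) b + reynolds_br brL RL a (d b)"
  by (simp add: reynolds_br_def d_lin.add d_lin.diff d_br d_RL algebra_simps)

lemma obstruction_eq:
  "obstruction i brH RH brL RL s dV d =
    (cochain2 (\<lambda>a b. dV (\<psi> a b) - \<psi> (d a) b - \<psi> a (d b)),
     cochain1 (\<lambda>a. dV (\<xi> a) - \<xi> (d a)))"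
  by (simp add: obstruction_def Let_def cochain1_def[abs_def] cochain2_def[abs_def])

text \<open>Each cocycle identity for \<open>(\<psi>, \<xi>)\<close> is multilinear. The corresponding identity for the
  obstruction is obtained by applying \<open>d\<^sub>V\<close> to it and subtracting, for each argument in turn, the same
  identity with \<open>d\<close> applied to that argument. This matches because \<open>d\<close> is a derivation and both maps
  commute with the operators.\<close>

lemma obstruction_cocycle:
  "obstruction i brH RH brL RL s dV d \<in> cocycles2 scaleL brL RL scaleV RV"
  unfolding obstruction_eq
proof (rule cocycles2I)
  show "Vector_Spaces.linear scaleL scaleV (\<lambda>a. dV (\<psi> a b) - \<psi> (d a) b - \<psi> a (d b))" for b
    by (simp add: Vector_Spaces.linear_iff p.cod.vector_space_axioms i.dom.vector_space_axioms
        psi_left.add psi_left.scale dV_lin.add dV_lin.scale d_lin.add d_lin.scale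
        i.dom.scale_right_diff_distrib)
  show "Vector_Spaces.linear scaleL scaleV (\<lambda>b. dV (\<psi> a b) - \<psi> (d a) b - \<psi> a (d b))" for a
    by (simp add: Vector_Spaces.linear_iff p.cod.vector_space_axioms i.dom.vector_space_axioms
        psi_right.add psi_right.scale dV_lin.add dV_lin.scale d_lin.add d_lin.scale
        i.dom.scale_right_diff_distrib)
  show "dV (\<psi> a a) - \<psi> (d a) a - \<psi> a (d a) = 0" for a
    using psi_antisym[of a "d a"] by (simp add: psi_self dV_lin.zero)
  show "Vector_Spaces.linear scaleL scaleV (\<lambda>a. dV (\<xi> a) - \<xi> (d a))"
    by (simp add: Vector_Spaces.linear_iff p.cod.vector_space_axioms i.dom.vector_space_axioms
        xi_lin.add xi_lin.scale dV_lin.add dV_lin.scale d_lin.add d_lin.scale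
        i.dom.scale_right_diff_distrib)
next
  fix a b c
  have "dV (\<psi> (brL a b) c) - dV (\<psi> (brL a c) b) + dV (\<psi> (brL b c) a) = 0"
    using arg_cong[OF psi_jacobi[of a b c], of dV]
    by (simp add: dV_lin.add dV_lin.diff dV_lin.zero)
  moreover have "dV (\<psi> (brL a b) c) - \<psi> (d (brL a b)) c - \<psi> (brL a b) (d c) -
      (dV (\<psi> (brL a c) b) - \<psi> (d (brL a c)) b - \<psi> (brL a c) (d b)) +
      (dV (\<psi> (brL b c) a) - \<psi> (d (brL b c)) a - \<psi> (brL b c) (d a)) =
      (dV (\<psi> (brL a b) c) - dV (\<psi> (brL a c) b) + dV (\<psi> (brL b c) a)) -
      (\<psi> (brL (d a) b) c - \<psi> (brL (d a) c) b + \<psi> (brL b c) (d a)) -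
      (\<psi> (brL a (d b)) c - \<psi> (brL a c) (d b) + \<psi> (brL (d b) c) a) -
      (\<psi> (brL a b) (d c) - \<psi> (brL a (d c)) b + \<psi> (brL b (d c)) a)"
    by (simp add: d_br psi_left.add algebra_simps)
  ultimately show "dV (\<psi> (brL a b) c) - \<psi> (d (brL a b)) c - \<psi> (brL a b) (d c) -
      (dV (\<psi> (brL a c) b) - \<psi> (d (brL a c)) b - \<psi> (brL a c) (d b)) +
      (dV (\<psi> (brL b c) a) - \<psi> (d (brL b c)) a - \<psi> (brL b c) (d a)) = 0"
    by (simp only: psi_jacobi diff_zero)
next
  fix a b
  let ?F = "\<lambda>a b. dV (\<psi> a b) - \<psi> (d a) b - \<psi> a (d b)"
  show "dV (\<xi> (reynolds_br brL RL a b)) - \<xi> (d (reynolds_br brL RL a b)) =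
      ?F (RL a) (RL b) - RV (?F a (RL b) + ?F (RL a) b - ?F (RL a) (RL b))"
    by (simp add: d_reynolds_br xi_lin.add psi_xi_reynolds d_RL dV_RV RV_simps
        dV_lin.add dV_lin.diff algebra_simps)
qed

text \<open>The conditions that involve only \<open>(V, R\<^sub>V, d\<^sub>V)\<close>, \<open>(L, R, d)\<close> or the given extension hold
  from the outset; what remains are conditions on the lift.\<close>

lemma extensible_iff:
  "extensible scaleV RV i scaleH brH RH p scaleL brL RL dV d \<longleftrightarrow>
    (\<exists>dH. lie_derivation scaleH brH dH \<and> RH \<circ> dH = dH \<circ> RH \<and> i \<circ> dV = dH \<circ> i \<and> p \<circ> dH = d \<circ> p)"
proof -
  have V: "reynolds_lieder_pair scaleV (\<lambda>_ _. 0) RV dV"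
  proof unfold_locales
    show "lie_derivation scaleV (\<lambda>_ _. 0) dV"
      by (simp add: lie_derivation_def dV_lin.zero dV_lin.linear_axioms)
    show "RV \<circ> dV = dV \<circ> RV"
      by (simp add: fun_eq_iff dV_RV)
  qed
  have L: "reynolds_lieder_pair scaleL brL RL d"
  proof unfold_locales
    show "lie_derivation scaleL brL d"
      using d by (simp add: Der_def)
    show "RL \<circ> d = d \<circ> RL"
      by (simp add: fun_eq_iff d_RL)
  qed
  have H: "reynolds_lieder_pair scaleH brH RH dH \<longleftrightarrow>
      lie_derivation scaleH brH dH \<and> RH \<circ> dH = dH \<circ> RH" for dH
    by (simp only: reynolds_lieder_pair_def reynolds_lieder_pair_axioms_def
        i.cod.reynolds_lie_algebra_axioms simp_thms)
  show ?thesis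
    unfolding extensible_def reynolds_lieder_hom_def reynolds_lieder_hom_axioms_def
    using V L H exact i.reynolds_lie_hom_axioms p.reynolds_lie_hom_axioms by blast
qed

lemma obstruction_coboundary_iff:
  "obstruction i brH RH brL RL s dV d \<in> coboundaries2 scaleL brL RL scaleV RV \<longleftrightarrow>
    (\<exists>l. Vector_Spaces.linear scaleL scaleV l \<and>
      (\<forall>a b. dV (\<psi> a b) - \<psi> (d a) b - \<psi> a (d b) = - l (brL a b)) \<and>
      (\<forall>a. dV (\<xi> a) - \<xi> (d a) = RV (l a) - l (RL a)))"
  unfolding coboundaries2_eq obstruction_eq by (simp add: image_iff) (simp add: fun_eq_iff)

text \<open>Apply \<open>q\<close> to the derivation rule at \<open>s a\<close>, \<open>s b\<close> and to the commutation with the Reynolds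
  operator at \<open>s a\<close>.\<close>

lemma extensible_imp_coboundary:
  assumes "extensible scaleV RV i scaleH brH RH p scaleL brL RL dV d"
  shows "obstruction i brH RH brL RL s dV d \<in> coboundaries2 scaleL brL RL scaleV RV"
proof -
  obtain dH where dH_lin: "Vector_Spaces.linear scaleH scaleH dH"
    and dH_br: "\<And>x y. dH (brH x y) = brH (dH x) y + brH x (dH y)"
    and dH_RH: "\<And>x. RH (dH x) = dH (RH x)"
    and dH_i: "\<And>v. dH (i v) = i (dV v)"
    and p_dH: "\<And>x. p (dH x) = d (p x)"
    using assms unfolding extensible_iff lie_derivation_def by (auto simp: fun_eq_iff)
  interpret dH: Vector_Spaces.linear scaleH scaleH dH by (fact dH_lin)
  \<comment> \<open>The primitive measures how far the lift is from mapping \<open>s a\<close> to \<open>s (d a)\<close>.\<close>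
  define l where "l = (\<lambda>a. q (dH (s a)))"
  have l_linear: "Vector_Spaces.linear scaleL scaleV l"
    using Vector_Spaces.linear_compose[OF s_lin.linear_axioms Vector_Spaces.linear_compose[OF dH_lin q_linear]]
    by (simp add: l_def o_def)
  have q_dH: "q (dH h) = dV (q h) + l (p h)" for h
  proof -
    have "q (dH (i (q h) + s (p h))) = dV (q h) + l (p h)"
      by (simp add: dH.add dH_i q_lin.add l_def)
    then show ?thesis
      by (simp flip: decompose)
  qed
  have "dV (\<psi> a b) - \<psi> (d a) b - \<psi> a (d b) = - l (brL a b)" for a b
    using arg_cong[OF dH_br[of "s a" "s b"], of q]
    by (simp add: q_dH q_lin.add q_br p_dH algebra_simps)
  moreover have "dV (\<xi> a) - \<xi> (d a) = RV (l a) - l (RL a)" for a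
    using arg_cong[OF dH_RH[of "s a"], of q]
    by (simp add: q_dH q_RH p_dH RV_simps dV_lin.zero algebra_simps)
  ultimately show ?thesis
    unfolding obstruction_coboundary_iff using l_linear by blast
qed

text \<open>A primitive \<open>l\<close> of the obstruction prescribes a lift of \<open>d\<close>. The identities for the lift are
  checked on their components under \<open>q\<close> and \<open>p\<close>: under \<open>q\<close> they say that \<open>l\<close> is a primitive, under
  \<open>p\<close> they are the identities for \<open>d\<close>.\<close>

lemma coboundary_imp_extensible:
  assumes "obstruction i brH RH brL RL s dV d \<in> coboundaries2 scaleL brL RL scaleV RV"
  shows "extensible scaleV RV i scaleH brH RH p scaleL brL RL dV d"
proof -
  obtain l where l_linear: "Vector_Spaces.linear scaleL scaleV l"
    and Ob2: "\<And>a b. dV (\<psi> a b) - \<psi> (d a) b - \<psi> a (d b) = - l (brL a b)"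
    and Ob1: "\<And>a. dV (\<xi> a) - \<xi> (d a) = RV (l a) - l (RL a)"
    using assms unfolding obstruction_coboundary_iff by blast
  interpret l: Vector_Spaces.linear scaleL scaleV l by (fact l_linear)
  \<comment> \<open>The only map that extends \<open>d\<^sub>V\<close>, lifts \<open>d\<close> and has \<open>q (d' (s a)) = l a\<close>.\<close>
  define dH where "dH = (\<lambda>h. i (dV (q h) + l (p h)) + s (d (p h)))"
  have p_dH: "p (dH h) = d (p h)" for h
    by (simp add: dH_def additive_simps)
  have q_dH: "q (dH h) = dV (q h) + l (p h)" for h
    by (simp add: dH_def q_lin.add)
  have eqI: "x = y" if "q x = q y" "p x = p y" for x y
  proof -
    have "i (q x) + s (p x) = i (q y) + s (p y)"
      by (simp only: that)
    then show "x = y"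
      by (simp flip: decompose)
  qed
  have "Vector_Spaces.linear scaleH scaleH dH"
    by (simp add: Vector_Spaces.linear_iff i.cod.vector_space_axioms dH_def additive_simps
        q_lin.add l.add d_lin.add dV_lin.add q_lin.scale l.scale d_lin.scale dV_lin.scale
        i_lin.scale s_lin.scale p_lin.scale i.cod.scale_right_distrib)
  moreover have "dH (brH x y) = brH (dH x) y + brH x (dH y)" for x y
  proof (rule eqI)
    show "q (dH (brH x y)) = q (brH (dH x) y + brH x (dH y))"
      using Ob2[of "p x" "p y"]
      by (simp add: q_dH q_br q_lin.add p_dH algebra_simps)
    show "p (dH (brH x y)) = p (brH (dH x) y + brH x (dH y))"
      by (simp add: p_dH p_lin.add d_br)
  qed
  moreover have "RH (dH x) = dH (RH x)" for x
  proof (rule eqI)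
    show "q (RH (dH x)) = q (dH (RH x))"
      using Ob1[of "p x"]
      by (simp add: q_dH q_RH p_dH RV_simps dV_lin.add dV_RV algebra_simps)
    show "p (RH (dH x)) = p (dH (RH x))"
      by (simp add: p_dH d_RL)
  qed
  moreover have "i (dV v) = dH (i v)" for v
    by (simp add: dH_def additive_simps l.zero d_lin.zero)
  ultimately show ?thesis
    unfolding extensible_iff lie_derivation_def using p_dH by (auto simp: fun_eq_iff)
qed

lemma extensible_iff_obstruction_class_zero:
  "extensible scaleV RV i scaleH brH RH p scaleL brL RL dV d \<longleftrightarrow>
    cohomology_class2 scaleL brL RL scaleV RV (obstruction i brH RH brL RL s dV d) =
    cohomology_class2 scaleL brL RL scaleV RV 0"
  using extensible_imp_coboundary coboundary_imp_extensible
    cohomology_class2_eq_zero_iff[OF obstruction_cocycle] by blast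

end

end

theorem theorem6p2:
  fixes scaleV :: "'k::field \<Rightarrow> 'v::ab_group_add \<Rightarrow> 'v" and RV :: "'v \<Rightarrow> 'v"
    and scaleH :: "'k \<Rightarrow> 'h::ab_group_add \<Rightarrow> 'h" and brH :: "'h \<Rightarrow> 'h \<Rightarrow> 'h" and RH :: "'h \<Rightarrow> 'h"
    and scaleL :: "'k \<Rightarrow> 'l::ab_group_add \<Rightarrow> 'l" and brL :: "'l \<Rightarrow> 'l \<Rightarrow> 'l" and RL :: "'l \<Rightarrow> 'l"
    and i :: "'v \<Rightarrow> 'h" and p :: "'h \<Rightarrow> 'l" and s :: "'l \<Rightarrow> 'h"
    and dV :: "'v \<Rightarrow> 'v" and d :: "'l \<Rightarrow> 'l"
  assumes "central_extension scaleV RV i scaleH brH RH p scaleL brL RL"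
    and "linear_section scaleL scaleH p s"
    and "dV \<in> abelian_Der scaleV RV"
    and "d \<in> Der scaleL brL RL"
  shows "extensible scaleV RV i scaleH brH RH p scaleL brL RL dV d \<longleftrightarrow>
    cohomology_class2 scaleL brL RL scaleV RV (obstruction i brH RH brL RL s dV d) =
    cohomology_class2 scaleL brL RL scaleV RV 0"
proof -
  interpret split_central_extension scaleV RV i scaleH brH RH p scaleL brL RL s
    using assms(1,2)
    by (simp add: split_central_extension_def split_central_extension_axioms_def)
  show ?thesis
    using assms(3,4) by (rule extensible_iff_obstruction_class_zero)
qed

end
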